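(* Let $(X,d,\mu)$ be an $s$-Ahlfors-regular quasi-metric measure space. Assume that $\Psi:[1,\infty)\to(0,\infty)$ is increasing and satisfies $\lim_{t\to\infty}\Psi(t)=\infty$. Then for all $1<q\le\infty$ and all $v>-1$, $$B^{0,v}_q(X)\nsubseteq L(\log^+L)^{1+v}\Psi(L)(X).$$
   Context: An $s$-Ahlfors-regular quasi-metric measure space $(X,d,\mu)$ is a set $X$ (with at least two points) with a function $d:X\times X\to[0,\infty)$ such that $d(x,y)=d(y,x)$; $d(x,y)=0$ iff $x=y$; and for some constant $A\ge 1$, $d(x,y)\le A(d(x,z)+d(z,y))$ for all $x,y,z\in X$; together with a nonzero Borel regular measure $\mu$ on $X$ for which there are constants $c,C,s>0$ with $$c\,r^s\le\mu(B(x,r))\le C\,r^s,\qquad x\in X,\ 0<r<\operatorname{diam}(X),$$ where $B(x,r)=\{y\in X:d(x,y)<r\}$ (a ball) and $\operatorname{diam}(X)=\sup\{d(x,y):x,y\in X\}\in[0,\infty]$. Balls are understood to be $\mu$-measurable. Write $\log^+t=\max\{\log t,0\}$, and let $q'$ be the conjugate exponent of $q$ ($\infty'=1$). For $k\ge0$, $v>-1$, $t>0$ set $\phi_{k,v}(t)=\chi_{(0,1)}(t)\int_t^1 s^{-1-k}(\log^+(1/s))^v\,ds$; in particular $\phi_{0,v}(t)=\frac1{1+v}(\log^+(1/t))^{1+v}$. $q$-block: for $1<q\le\infty$, a measurable function $a$ on $X$ is a $q$-block (supported on $B$) if $B\subset X$ is a ball with $0<\mu(B)<\infty$, $\operatorname{supp}a\subseteq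 B$ (i.e. $a$ vanishes outside $B$), and $\|a\|_{L^q(B)}\le\mu(B)^{-1/q'}$. Block space $B^{0,v}_q(X)$: all $f\in L^1(X)$ admitting a decomposition $f=\sum_{j=1}^\infty\lambda_ja_j$ with $\lambda_j\in\mathbb C$, each $a_j$ a $q$-block supported on a ball $B_j$, and $\sum_{j=1}^\infty|\lambda_j|(1+\phi_{0,v}(\mu(B_j)))<\infty$. (Since $\|a_j\|_{L^1}\le1$, the series converges absolutely in $L^1(X)$.) The space $L(\log^+L)^{1+v}\Psi(L)(X)$ is the set of $f\in L^1(X)$ with $$\int_X|f(x)|\,(\log(2+|f(x)|))^{1+v}\,\Psi(|f(x)|)\,d\mu(x)<\infty,$$ where $\Psi$ is extended by $\Psi(t)=\Psi(1)$ for $0\le t<1$. *)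

theory Defs
  imports "HOL-Probability.Essential_Supremum"
begin

definition qball :: "'a set \<Rightarrow> ('a \<Rightarrow> 'a \<Rightarrow> real) \<Rightarrow> 'a \<Rightarrow> real \<Rightarrow> 'a set" where
  "qball X d x r = {y \<in> X. d x y < r}"

definition is_qball :: "'a set \<Rightarrow> ('a \<Rightarrow> 'a \<Rightarrow> real) \<Rightarrow> 'a set \<Rightarrow> bool" where
  "is_qball X d B \<longleftrightarrow> (\<exists>x\<in>X. \<exists>r>0. B = qball X d x r)"

definition qdiam :: "'a set \<Rightarrow> ('a \<Rightarrow> 'a \<Rightarrow> real) \<Rightarrow> ereal" where
  "qdiam X d = (SUP x\<in>X. SUP y\<in>X. ereal (d x y))"

text \<open>The topology of a quasi-metric: balls need not be open (nor Borel), but they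
  determine the open sets.\<close>

definition qopen :: "'a set \<Rightarrow> ('a \<Rightarrow> 'a \<Rightarrow> real) \<Rightarrow> 'a set \<Rightarrow> bool" where
  "qopen X d U \<longleftrightarrow> U \<subseteq> X \<and> (\<forall>x\<in>U. \<exists>r>0. qball X d x r \<subseteq> U)"

definition qborel_sets :: "'a set \<Rightarrow> ('a \<Rightarrow> 'a \<Rightarrow> real) \<Rightarrow> 'a set set" where
  "qborel_sets X d = sigma_sets X {U. qopen X d U}"

locale quasi_metric_space =
  fixes X :: "'a set" and d :: "'a \<Rightarrow> 'a \<Rightarrow> real"
  assumes two_points: "\<exists>x\<in>X. \<exists>y\<in>X. x \<noteq> y"
    and nonneg: "\<lbrakk>x \<in> X; y \<in> X\<rbrakk> \<Longrightarrow> 0 \<le> d x y"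
    and sym: "\<lbrakk>x \<in> X; y \<in> X\<rbrakk> \<Longrightarrow> d x y = d y x"
    and zero_iff: "\<lbrakk>x \<in> X; y \<in> X\<rbrakk> \<Longrightarrow> d x y = 0 \<longleftrightarrow> x = y"
    and quasi_triangle:
      "\<exists>A\<ge>1. \<forall>x\<in>X. \<forall>y\<in>X. \<forall>z\<in>X. d x y \<le> A * (d x z + d z y)"

text \<open>The \<open>\<sigma>\<close>-algebra of \<open>M\<close> may be larger than the Borel one (for instance the
  Caratheodory-measurable sets of a Borel regular outer measure).\<close>

locale ahlfors_regular_space = quasi_metric_space X d
  for X :: "'a set" and d :: "'a \<Rightarrow> 'a \<Rightarrow> real" +
  fixes M :: "'a measure" and s :: real
  assumes space_eq: "space M = X"
    and borel_measurable_sets: "qborel_sets X d \<subseteq> sets M"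
    and borel_regular:
      "A \<in> sets M \<Longrightarrow> \<exists>E\<in>qborel_sets X d. A \<subseteq> E \<and> emeasure M E = emeasure M A"
    and ball_measurable: "x \<in> X \<Longrightarrow> qball X d x r \<in> sets M"
    and nonzero: "emeasure M X \<noteq> 0"
    and s_pos: "s > 0"
    and ahlfors_regular:
      "\<exists>c>0. \<exists>C>0. \<forall>x\<in>X. \<forall>r>0. ereal r < qdiam X d \<longrightarrow>
         ennreal (c * r powr s) \<le> emeasure M (qball X d x r) \<and>
         emeasure M (qball X d x r) \<le> ennreal (C * r powr s)"

definition log_plus :: "real \<Rightarrow> real" where
  "log_plus t = max (ln t) 0"

text \<open>At \<open>u = 1\<close> the convention \<open>0 powr v = 0\<close> only affects a null set.\<close>

definition phi :: "real \<Rightarrow> real \<Rightarrow> real \<Rightarrow> real" where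
  "phi k v t = indicator {0<..<1} t *
     (LBINT u:{t..1}. u powr (-1 - k) * log_plus (1 / u) powr v)"

text \<open>Exponents range over \<open>1 < q \<le> \<infinity>\<close>.\<close>

definition conj_exponent :: "ereal \<Rightarrow> real" where
  "conj_exponent q = (if q = \<infinity> then 1 else real_of_ereal q / (real_of_ereal q - 1))"

text \<open>\<open>enn2real\<close> sends \<open>\<infinity>\<close> to \<open>0\<close>, hence the separate case for an infinite integral.\<close>

definition Lq_norm :: "'a measure \<Rightarrow> ereal \<Rightarrow> ('a \<Rightarrow> complex) \<Rightarrow> ennreal" where
  "Lq_norm M q f =
     (if q = \<infinity> then esssup M (\<lambda>x. ennreal (norm (f x)))
      else let p = real_of_ereal q; I = (\<integral>\<^sup>+x. ennreal (norm (f x) powr p) \<partial>M)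
           in if I = \<infinity> then \<infinity> else ennreal (enn2real I powr (1 / p)))"

definition q_block ::
  "'a set \<Rightarrow> ('a \<Rightarrow> 'a \<Rightarrow> real) \<Rightarrow> 'a measure \<Rightarrow> ereal \<Rightarrow> ('a \<Rightarrow> complex) \<Rightarrow> 'a set \<Rightarrow> bool" where
  "q_block X d M q a B \<longleftrightarrow>
     a \<in> borel_measurable M \<and>
     is_qball X d B \<and> 0 < emeasure M B \<and> emeasure M B < \<infinity> \<and>
     (\<forall>x\<in>X - B. a x = 0) \<and>
     Lq_norm (restrict_space M B) q a \<le> ennreal (measure M B powr (- 1 / conj_exponent q))"

text \<open>Elements are functions rather than classes modulo equality almost everywhere; the
  set is closed under changes on null sets because the series is only required to
  converge in \<open>L\<^sup>1\<close>.\<close>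

definition block_space ::
  "'a set \<Rightarrow> ('a \<Rightarrow> 'a \<Rightarrow> real) \<Rightarrow> 'a measure \<Rightarrow> ereal \<Rightarrow> real \<Rightarrow> ('a \<Rightarrow> complex) set" where
  "block_space X d M q v = {f. integrable M f \<and>
     (\<exists>(c :: nat \<Rightarrow> complex) a B.
        (\<forall>j. q_block X d M q (a j) (B j)) \<and>
        summable (\<lambda>j. norm (c j) * (1 + phi 0 v (measure M (B j)))) \<and>
        (\<lambda>n. \<integral>\<^sup>+x. ennreal (norm (f x - (\<Sum>j<n. c j * a j x))) \<partial>M) \<longlonglongrightarrow> 0)}"

definition extend_Psi :: "(real \<Rightarrow> real) \<Rightarrow> real \<Rightarrow> real" where
  "extend_Psi \<Psi> t = (if t < 1 then \<Psi> 1 else \<Psi> t)"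

definition LlogL_Psi :: "'a measure \<Rightarrow> real \<Rightarrow> (real \<Rightarrow> real) \<Rightarrow> ('a \<Rightarrow> complex) set" where
  "LlogL_Psi M v \<Psi> = {f. integrable M f \<and>
     (\<integral>\<^sup>+x. ennreal (norm (f x) * ln (2 + norm (f x)) powr (1 + v)
        * extend_Psi \<Psi> (norm (f x))) \<partial>M) < \<infinity>}"

end

theory Submission
  imports Defs "HOL-Real_Asymp.Real_Asymp"
begin

text \<open>Fix a point and let \<open>B\<^sub>j\<close> be balls around it whose measures \<open>m\<^sub>j\<close> tend to \<open>0\<close> very
  fast. The normalized indicators \<open>\<chi>\<^bsub>B\<^sub>j\<^esub> / m\<^sub>j\<close> are \<open>q\<close>-blocks, so with the weights
  \<open>c\<^sub>j = 2\<^sup>-\<^sup>j / (1 + \<phi>(m\<^sub>j))\<close> the sum \<open>f = \<Sum>j. c\<^sub>j \<chi>\<^bsub>B\<^sub>j\<^esub> / m\<^sub>j\<close> lies in the block space. On \<open>B\<^sub>j\<close> we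
  have \<open>f \<ge> c\<^sub>j / m\<^sub>j \<ge> m\<^sub>j powr (-1/2)\<close>; since \<open>\<phi>(m\<^sub>j)\<close> is comparable to \<open>ln (1/m\<^sub>j) powr (1 + v)\<close>, the
  Orlicz integral over \<open>B\<^sub>j\<close> is at least a constant times \<open>2\<^sup>-\<^sup>j \<Psi>(m\<^sub>j powr (-1/2))\<close>, and \<open>m\<^sub>j\<close> can be
  chosen so small that \<open>\<Psi>(m\<^sub>j powr (-1/2)) \<ge> 4\<^sup>j\<close>.\<close>

text \<open>The integrand is the derivative of \<open>- ((- ln u) powr (1 + v) / (1 + v))\<close>.
  For \<open>v < 0\<close> it blows up at \<open>u = 1\<close>, but since \<open>1 + v > 0\<close>
  the antiderivative stays continuous there, so the fundamental theorem applies with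
  differentiability only in the interior.\<close>

lemma phi_0_eq:
  fixes t v :: real
  assumes t: "0 < t" "t < 1" and v: "v > -1"
  shows "phi 0 v t = ln (1 / t) powr (1 + v) / (1 + v)"
proof -
  define g where "g u = u powr (-1 - 0) * log_plus (1 / u) powr v" for u
  define G where "G u = - ((- ln u) powr (1 + v) / (1 + v))" for u :: real
  have [measurable]: "g \<in> borel_measurable borel"
    unfolding g_def log_plus_def by measurable
  have "(g has_integral (G 1 - G t)) {t..1}"
  proof (rule fundamental_theorem_of_calculus_interior)
    show "continuous_on {t..1} G"
      unfolding G_def using t v by (intro continuous_intros continuous_on_powr') auto
    show "(G has_vector_derivative g u) (at u)" if "u \<in> {t<..<1}" for u
    proof -
      have u: "0 < u" "u < 1" using that t by auto
      have "(G has_real_derivative (1 / u) * (- ln u) powr v) (at u)"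
        unfolding G_def using u v
        by (auto intro!: derivative_eq_intros simp: divide_simps)
      moreover have "g u = (1 / u) * (- ln u) powr v"
        using u by (simp add: g_def log_plus_def ln_div powr_minus_divide)
      ultimately have "(G has_real_derivative g u) (at u)" by simp
      then show ?thesis by (simp add: has_real_derivative_iff_has_vector_derivative)
    qed
  qed (use t in auto)
  then have hk: "g integrable_on {t..1}" "integral {t..1} g = G 1 - G t"
    by (auto simp: has_integral_iff)
  \<comment> \<open>\<open>phi\<close> is a Lebesgue integral, while the value found so far is a
    gauge integral. The sign of \<open>g\<close> bridges the two, even where \<open>g\<close> is
    unbounded.\<close>
  have "g absolutely_integrable_on {t..1}"
    by (rule nonnegative_absolutely_integrable_1[OF hk(1)]) (use t in \<open>auto simp: g_def\<close>)
  then have "set_integrable lborel {t..1} g"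
    unfolding set_integrable_def by (subst (asm) integrable_completion) measurable
  then have "(LBINT u:{t..1}. g u) = G 1 - G t"
    using set_borel_integral_eq_integral(2) hk(2) by metis
  then show ?thesis
    using t v by (simp add: phi_def g_def G_def ln_div)
qed

text \<open>On \<open>B\<close> the function is the constant \<open>1 / m\<close>, whose norm is
  \<open>m powr (1/q - 1)\<close>: exactly the size allowed to a block.\<close>

lemma q_block_normalized_indicator:
  assumes B: "B \<in> sets M" "is_qball (space M) d B" "0 < emeasure M B" "emeasure M B < \<infinity>"
    and q: "1 < q"
  shows "q_block (space M) d M q (\<lambda>x. of_real (indicator B x / measure M B)) B"
proof -
  define m where "m = measure M B"
  have em: "emeasure M B = ennreal m"
    using B(4) by (simp add: m_def emeasure_eq_ennreal_measure)
  have m: "m > 0" using B(3) em by simp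
  define a where "a x = complex_of_real (indicator B x / m)" for x
  have [measurable]: "B \<in> sets M" by fact
  have a_meas[measurable]: "a \<in> borel_measurable M" unfolding a_def by measurable
  have [measurable]: "a \<in> borel_measurable (restrict_space M B)"
    by (rule measurable_restrict_space1[OF a_meas])
  have "Lq_norm (restrict_space M B) q a \<le> ennreal (m powr (- 1 / conj_exponent q))"
  proof (cases "q = \<infinity>")
    case True
    have "esssup (restrict_space M B) (\<lambda>x. ennreal (norm (a x))) \<le> ennreal (m powr -1)"
    proof (rule esssup_I)
      show "AE x in restrict_space M B. ennreal (norm (a x)) \<le> ennreal (m powr -1)"
        using m by (intro AE_I2) (simp add: a_def space_restrict_space powr_minus_divide norm_divide)
    qed measurable
    then show ?thesis using True by (simp add: Lq_norm_def conj_exponent_def)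
  next
    case False
    then obtain p where qp: "q = ereal p" using q by (cases q) auto
    have p: "p > 1" using q qp by simp
    have "(\<integral>\<^sup>+x. ennreal (norm (a x) powr p) \<partial>restrict_space M B)
        = (\<integral>\<^sup>+x. ennreal (m powr - p) * indicator B x \<partial>M)"
      using m
      by (subst nn_integral_restrict_space)
         (auto intro!: nn_integral_cong
           simp: a_def indicator_def norm_divide powr_divide powr_minus_divide)
    also have "\<dots> = ennreal (m powr - p) * ennreal m"
      by (subst nn_integral_cmult_indicator) (auto simp: em)
    also have "\<dots> = ennreal (m powr (1 - p))"
      using m by (simp add: ennreal_mult[symmetric] powr_diff powr_minus_divide)
    finally have I: "(\<integral>\<^sup>+x. ennreal (norm (a x) powr p) \<partial>restrict_space M B) = ennreal (m powr (1 - p))" .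
    have "(1 - p) / p = - 1 / conj_exponent q"
      using p by (simp add: conj_exponent_def qp field_simps)
    then show ?thesis
      using I p by (simp add: Lq_norm_def qp powr_powr)
  qed
  then show ?thesis
    using B a_meas unfolding q_block_def a_def m_def by auto
qed

text \<open>Monotone convergence turns each tail of the series into a tail of the summable
  \<open>c\<close>, and finite integrals force finiteness almost everywhere. Where the series
  diverges, its sum is a meaningless default value, confined to a null set.\<close>

lemma L1_series:
  fixes f :: "nat \<Rightarrow> 'a \<Rightarrow> real"
  assumes [measurable]: "\<And>j. f j \<in> borel_measurable M"
    and nn: "\<And>j x. 0 \<le> f j x"
    and int: "\<And>j. (\<integral>\<^sup>+x. ennreal (f j x) \<partial>M) = ennreal (c j)"
    and c: "\<And>j. 0 \<le> c j" "summable c"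
  shows "AE x in M. summable (\<lambda>j. f j x)"
    and "integrable M (\<lambda>x. \<Sum>j. f j x)"
    and "(\<lambda>n. \<integral>\<^sup>+x. ennreal \<bar>(\<Sum>j. f j x) - (\<Sum>j<n. f j x)\<bar> \<partial>M) \<longlonglongrightarrow> 0"
proof -
  have tail: "(\<integral>\<^sup>+x. (\<Sum>j. ennreal (f (j + n) x)) \<partial>M) = ennreal (\<Sum>j. c (j + n))" for n
  proof -
    have "(\<integral>\<^sup>+x. (\<Sum>j. ennreal (f (j + n) x)) \<partial>M) = (\<Sum>j. ennreal (c (j + n)))"
      by (subst nn_integral_suminf) (auto simp: int)
    also have "\<dots> = ennreal (\<Sum>j. c (j + n))"
      using c by (intro suminf_ennreal2) (auto simp: summable_iff_shift)
    finally show ?thesis .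
  qed
  have "AE x in M. (\<Sum>j. ennreal (f j x)) \<noteq> \<infinity>"
    by (rule nn_integral_PInf_AE) (use tail[of 0] in auto)
  then show summ: "AE x in M. summable (\<lambda>j. f j x)"
    by eventually_elim (auto intro!: summable_suminf_not_top nn)
  have tail': "(\<integral>\<^sup>+x. ennreal \<bar>(\<Sum>j. f j x) - (\<Sum>j<n. f j x)\<bar> \<partial>M) = ennreal (\<Sum>j. c (j + n))" for n
  proof -
    have "(\<integral>\<^sup>+x. ennreal \<bar>(\<Sum>j. f j x) - (\<Sum>j<n. f j x)\<bar> \<partial>M) = (\<integral>\<^sup>+x. (\<Sum>j. ennreal (f (j + n) x)) \<partial>M)"
    proof (rule nn_integral_cong_AE, use summ in eventually_elim)
      fix x assume s: "summable (\<lambda>j. f j x)"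
      then have s': "summable (\<lambda>j. f (j + n) x)" by (rule summable_ignore_initial_segment)
      have "(\<Sum>j. f j x) - (\<Sum>j<n. f j x) = (\<Sum>j. f (j + n) x)"
        using suminf_minus_initial_segment[OF s, of n] by simp
      then show "ennreal \<bar>(\<Sum>j. f j x) - (\<Sum>j<n. f j x)\<bar> = (\<Sum>j. ennreal (f (j + n) x))"
        using s' nn by (simp add: suminf_ennreal2 suminf_nonneg)
    qed
    then show ?thesis using tail by simp
  qed
  \<comment> \<open>For \<open>n = 0\<close> the partial sum is empty, so the tail is the whole
    norm.\<close>
  show "integrable M (\<lambda>x. \<Sum>j. f j x)"
    by (rule integrableI_bounded) (use tail'[of 0] in auto)
  have "(\<lambda>n. ennreal (\<Sum>j. c (j + n))) \<longlonglongrightarrow> ennreal 0"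
    by (intro tendsto_ennrealI suminf_exist_split2 c)
  then show "(\<lambda>n. \<integral>\<^sup>+x. ennreal \<bar>(\<Sum>j. f j x) - (\<Sum>j<n. f j x)\<bar> \<partial>M) \<longlonglongrightarrow> 0"
    by (simp add: tail')
qed

text \<open>Two distinct points \<open>x\<close>, \<open>y\<close> make every radius below
  \<open>d x y\<close> admissible for Ahlfors regularity. The upper bound then makes the measure
  small and the lower bound keeps it positive.\<close>

lemma (in ahlfors_regular_space) small_ball:
  assumes "\<epsilon> > 0"
  obtains B where "is_qball X d B" "B \<in> sets M" "emeasure M B < \<infinity>"
    "0 < measure M B" "measure M B < \<epsilon>"
proof -
  obtain x y where xy: "x \<in> X" "y \<in> X" "x \<noteq> y" using two_points by blast
  have dxy: "d x y > 0" using xy nonneg[of x y] zero_iff[of x y] by linarith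
  have "ereal (d x y) \<le> qdiam X d"
    unfolding qdiam_def using xy by (meson SUP_upper2 order_refl)
  obtain c C where cC: "c > 0" "C > 0" and reg: "\<And>r. r > 0 \<Longrightarrow> ereal r < qdiam X d \<Longrightarrow>
      ennreal (c * r powr s) \<le> emeasure M (qball X d x r) \<and>
      emeasure M (qball X d x r) \<le> ennreal (C * r powr s)"
    using ahlfors_regular xy by blast
  have "((\<lambda>r. C * r powr s) \<longlongrightarrow> 0) (at_right 0)"
    using s_pos by real_asymp
  then have "eventually (\<lambda>r. C * r powr s < \<epsilon>) (at_right 0)"
    using assms by (rule order_tendstoD)
  moreover have "eventually (\<lambda>r. r \<in> {0<..<d x y}) (at_right (0::real))"
    using dxy by (rule eventually_at_right_real)
  ultimately have "eventually (\<lambda>r. C * r powr s < \<epsilon> \<and> 0 < r \<and> r < d x y) (at_right 0)"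
    by eventually_elim auto
  then obtain r where r: "C * r powr s < \<epsilon>" "0 < r" "r < d x y"
    using eventually_happens[of _ "at_right (0::real)"] by auto
  have "ereal r < qdiam X d"
    using r(3) \<open>ereal (d x y) \<le> qdiam X d\<close> less_le_trans[of "ereal r" "ereal (d x y)"] by simp
  with reg r(2) have bd: "ennreal (c * r powr s) \<le> emeasure M (qball X d x r)"
      "emeasure M (qball X d x r) \<le> ennreal (C * r powr s)" by auto
  have fin: "emeasure M (qball X d x r) < \<infinity>"
    using bd(2) by (auto intro: le_less_trans)
  have em: "emeasure M (qball X d x r) = ennreal (measure M (qball X d x r))"
    using fin by (intro emeasure_eq_ennreal_measure) auto
  have "c * r powr s \<le> measure M (qball X d x r)" "measure M (qball X d x r) \<le> C * r powr s"
    using bd cC unfolding em by (auto simp: ennreal_le_iff)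
  moreover have "c * r powr s > 0" using cC r by simp
  ultimately show thesis
    using r xy fin ball_measurable by (intro that[of "qball X d x r"]) (auto simp: is_qball_def)
qed

theorem theorem1p5:
  fixes X :: "'a set" and d :: "'a \<Rightarrow> 'a \<Rightarrow> real" and M :: "'a measure"
    and s :: real and \<Psi> :: "real \<Rightarrow> real" and q :: ereal and v :: real
  assumes "ahlfors_regular_space X d M s"
    and "\<And>t. t \<ge> 1 \<Longrightarrow> \<Psi> t > 0"
    and "mono_on {1..} \<Psi>"
    and "filterlim \<Psi> at_top at_top"
    and "1 < q"
    and "v > -1"
  shows "\<not> block_space X d M q v \<subseteq> LlogL_Psi M v \<Psi>"
proof
  assume sub: "block_space X d M q v \<subseteq> LlogL_Psi M v \<Psi>"
  interpret ahlfors_regular_space X d M s by fact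
  note v = \<open>v > -1\<close>

  \<comment> \<open>Choice of balls of very small measure\<close>
  define \<Phi> where "\<Phi> m = ln (1 / m) powr (1 + v) / (1 + v)" for m :: real
  \<comment> \<open>The third condition gives the summand on the ball a height of at least
    \<open>m powr (-1/2)\<close>, a power whose logarithm is still half of
    \<open>ln (1 / m)\<close>. The second lets the 1 in \<open>1 + \<Phi> m\<close> be absorbed into
    the logarithm, and the fourth keeps the argument of \<open>\<Psi>\<close> in
    \<open>{1..}\<close>.\<close>
  have ev: "eventually (\<lambda>m::real. m < 1 \<and> 1 \<le> ln (1 / m) \<and> 2 ^ j * (1 + \<Phi> m) \<le> m powr (-1/2)
      \<and> 1 \<le> m powr (-1/2) \<and> 4 ^ j \<le> \<Psi> (m powr (-1/2))) (at_right 0)" for j :: nat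
  proof (intro eventually_conj)
    show "eventually (\<lambda>m::real. m < 1) (at_right 0)" by real_asymp
    show "eventually (\<lambda>m::real. 1 \<le> ln (1 / m)) (at_right 0)" by real_asymp
    have "eventually (\<lambda>m::real. c * (1 + \<Phi> m) \<le> m powr (-1/2)) (at_right 0)" for c
      unfolding \<Phi>_def using v by real_asymp
    then show "eventually (\<lambda>m. 2 ^ j * (1 + \<Phi> m) \<le> m powr (-1/2)) (at_right 0)" .
    show "eventually (\<lambda>m::real. 1 \<le> m powr (-1/2)) (at_right 0)" by real_asymp
    have "filterlim (\<lambda>m::real. m powr (-1/2)) at_top (at_right 0)" by real_asymp
    with \<open>filterlim \<Psi> at_top at_top\<close> have "filterlim (\<lambda>m. \<Psi> (m powr (-1/2))) at_top (at_right 0)"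
      by (rule filterlim_compose)
    then show "eventually (\<lambda>m. 4 ^ j \<le> \<Psi> (m powr (-1/2))) (at_right 0)"
      by (simp add: filterlim_at_top)
  qed
  have "\<exists>B. is_qball X d B \<and> B \<in> sets M \<and> emeasure M B < \<infinity> \<and> 0 < measure M B \<and> measure M B < 1
      \<and> 1 \<le> ln (1 / measure M B) \<and> 2 ^ j * (1 + \<Phi> (measure M B)) \<le> measure M B powr (-1/2)
      \<and> 1 \<le> measure M B powr (-1/2) \<and> 4 ^ j \<le> \<Psi> (measure M B powr (-1/2))" for j :: nat
  proof -
    obtain \<epsilon> :: real where "\<epsilon> > 0" and \<epsilon>: "\<And>m. 0 < m \<Longrightarrow> m < \<epsilon> \<Longrightarrow> m < 1 \<and> 1 \<le> ln (1 / m)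
        \<and> 2 ^ j * (1 + \<Phi> m) \<le> m powr (-1/2) \<and> 1 \<le> m powr (-1/2) \<and> 4 ^ j \<le> \<Psi> (m powr (-1/2))"
      using ev[of j] unfolding eventually_at_right_field by auto
    obtain B where "is_qball X d B" "B \<in> sets M" "emeasure M B < \<infinity>"
      "0 < measure M B" "measure M B < \<epsilon>" using small_ball[OF \<open>\<epsilon> > 0\<close>] .
    with \<epsilon>[of "measure M B"] show ?thesis by blast
  qed
  then obtain B :: "nat \<Rightarrow> 'a set" where
    ball: "\<And>j. is_qball X d (B j)" and B_meas[measurable]: "\<And>j. B j \<in> sets M"
    and fin: "\<And>j. emeasure M (B j) < \<infinity>" and pos: "\<And>j. 0 < measure M (B j)"
    and lt1: "\<And>j. measure M (B j) < 1" and ln1: "\<And>j. 1 \<le> ln (1 / measure M (B j))"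
    and quot: "\<And>j. 2 ^ j * (1 + \<Phi> (measure M (B j))) \<le> measure M (B j) powr (-1/2)"
    and ge1: "\<And>j. 1 \<le> measure M (B j) powr (-1/2)"
    and big: "\<And>j. 4 ^ j \<le> \<Psi> (measure M (B j) powr (-1/2))"
    by metis
  define m where "m j = measure M (B j)" for j
  note pos = pos[folded m_def] and lt1 = lt1[folded m_def] and ln1 = ln1[folded m_def]
    and quot = quot[folded m_def] and ge1 = ge1[folded m_def] and big = big[folded m_def]
  have em: "emeasure M (B j) = ennreal (m j)" for j
    using fin[of j] by (simp add: m_def emeasure_eq_ennreal_measure)
  have phi: "phi 0 v (m j) = \<Phi> (m j)" for j
    unfolding \<Phi>_def by (rule phi_0_eq) (use pos lt1 v in auto)
  have \<Phi>_nn: "0 \<le> \<Phi> (m j)" for j unfolding \<Phi>_def using v by simp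

  \<comment> \<open>The series and its membership in the block space\<close>
  define c where "c j = (1/2) ^ j / (1 + \<Phi> (m j))" for j :: nat
  have c_pos: "c j > 0" for j using \<Phi>_nn[of j] by (simp add: c_def)
  \<comment> \<open>These are the terms of the block space sum, which thus becomes
    geometric.\<close>
  have c_phi: "c j * (1 + \<Phi> (m j)) = (1/2) ^ j" for j
    using \<Phi>_nn[of j] by (simp add: c_def)
  have "c j \<le> (1/2) ^ j" for j
    unfolding c_def using \<Phi>_nn[of j] by (simp add: divide_le_eq mult_le_cancel_left1)
  then have c_sum: "summable c"
    by (intro summable_comparison_test'[OF summable_geometric[of "1/2::real"]])
       (use c_pos in \<open>auto simp: abs_of_pos\<close>)
  define g where "g j x = c j * (indicator (B j) x / m j)" for j x
  have g_meas[measurable]: "g j \<in> borel_measurable M" for j unfolding g_def by measurable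
  have g_nn: "0 \<le> g j x" for j x using c_pos[of j] pos[of j] by (simp add: g_def)
  have g_int: "(\<integral>\<^sup>+x. ennreal (g j x) \<partial>M) = ennreal (c j)" for j
  proof -
    have "(\<integral>\<^sup>+x. ennreal (g j x) \<partial>M) = (\<integral>\<^sup>+x. ennreal (c j / m j) * indicator (B j) x \<partial>M)"
      by (intro nn_integral_cong) (simp add: g_def indicator_def)
    also have "\<dots> = ennreal (c j / m j) * ennreal (m j)"
      by (simp add: nn_integral_cmult_indicator em)
    also have "\<dots> = ennreal (c j)"
      using c_pos[of j] pos[of j] by (simp add: ennreal_mult[symmetric])
    finally show ?thesis .
  qed
  note series = L1_series[OF g_meas g_nn g_int less_imp_le[OF c_pos] c_sum]
  define f where "f x = (\<Sum>j. g j x)" for x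
  have f_meas[measurable]: "f \<in> borel_measurable M" unfolding f_def by measurable
  let ?F = "\<lambda>x. complex_of_real (f x)"
  have "?F \<in> block_space X d M q v"
    unfolding block_space_def
  proof (intro CollectI conjI exI allI)
    show "integrable M ?F"
      using series(2) unfolding f_def by (intro integrable_of_real)
    show "q_block X d M q (\<lambda>x. of_real (indicator (B j) x / measure M (B j))) (B j)" for j
      using q_block_normalized_indicator[of "B j" M d q] ball fin pos em \<open>1 < q\<close> by (simp add: space_eq)
    show "summable (\<lambda>j. norm (complex_of_real (c j)) * (1 + phi 0 v (measure M (B j))))"
      using c_pos c_phi by (simp add: m_def[symmetric] phi abs_of_pos summable_geometric)
    have "norm (?F x - (\<Sum>j<n. of_real (c j) * of_real (indicator (B j) x / measure M (B j))))
        = \<bar>(\<Sum>j. g j x) - (\<Sum>j<n. g j x)\<bar>" for x n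
      unfolding f_def g_def m_def of_real_mult[symmetric] of_real_sum[symmetric]
        of_real_diff[symmetric] norm_of_real ..
    then show "(\<lambda>n. \<integral>\<^sup>+x. ennreal (norm (?F x - (\<Sum>j<n. of_real (c j) *
        of_real (indicator (B j) x / measure M (B j))))) \<partial>M) \<longlonglongrightarrow> 0"
      using series(3) by simp
  qed

  \<comment> \<open>Unboundedness of the Orlicz integral\<close>
  with sub have "?F \<in> LlogL_Psi M v \<Psi>" by blast
  then have finite: "(\<integral>\<^sup>+x. ennreal (\<bar>f x\<bar> * ln (2 + \<bar>f x\<bar>) powr (1 + v) * extend_Psi \<Psi> \<bar>f x\<bar>) \<partial>M) < \<infinity>"
    (is "?I < _") by (simp add: LlogL_Psi_def)
  \<comment> \<open>The numerator comes from the factor 1/2 in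
    \<open>ln (m j powr (-1/2)) = L / 2\<close>, the denominator from
    \<open>1 + \<Phi> (m j) \<le> L powr (1 + v) * (1 + 1 / (1 + v))\<close>.\<close>
  define K where "K = (1/2) powr (1 + v) / (1 + 1 / (1 + v))"
  have K: "K > 0" unfolding K_def using v by (simp add: add_pos_pos)
  \<comment> \<open>The ball \<open>B j\<close> alone contributes this much: the growth
    \<open>4 ^ j\<close> of \<open>\<Psi>\<close> beats the decay \<open>(1/2) ^ j\<close> of the
    weights.\<close>
  have lower: "ennreal (K * 2 ^ j) \<le> ?I" for j
  proof -
    define y where "y = c j / m j"
    have y: "m j powr (-1/2) \<le> y"
    proof -
      have "m j powr (-1/2) * (2 ^ j * (1 + \<Phi> (m j))) \<le> m j powr (-1/2) * m j powr (-1/2)"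
        using quot[of j] by (intro mult_left_mono) auto
      also have "\<dots> = 1 / m j"
        using pos[of j] by (simp add: powr_add[symmetric] powr_minus_divide)
      finally have "m j powr (-1/2) \<le> (1 / m j) / (2 ^ j * (1 + \<Phi> (m j)))"
        using \<Phi>_nn[of j] by (subst pos_le_divide_eq) auto
      then show ?thesis
        unfolding y_def c_def by (simp add: power_one_over mult_ac)
    qed
    define L where "L = ln (1 / m j)"
    have L: "1 \<le> L" using ln1 by (simp add: L_def)
    have "K * 2 ^ j \<le> c j * (L / 2) powr (1 + v) * 4 ^ j"
    proof -
      have "1 \<le> L powr (1 + v)" using L v by (simp add: ge_one_powr_ge_zero)
      then have "1 + \<Phi> (m j) \<le> L powr (1 + v) * (1 + 1 / (1 + v))"
        unfolding \<Phi>_def L_def[symmetric] by (simp add: algebra_simps)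
      then have "K * (1 + \<Phi> (m j)) \<le> K * (L powr (1 + v) * (1 + 1 / (1 + v)))"
        using K by (intro mult_left_mono) auto
      also have "\<dots> = (1/2) powr (1 + v) * L powr (1 + v)"
      proof -
        have "1 + 1 / (1 + v) \<noteq> 0" using v by (simp add: add_pos_pos less_imp_neq[symmetric])
        then show ?thesis by (simp add: K_def)
      qed
      also have "\<dots> = (L / 2) powr (1 + v)"
        using L by (simp add: powr_mult[symmetric])
      finally have "c j * 4 ^ j * (K * (1 + \<Phi> (m j))) \<le> c j * 4 ^ j * (L / 2) powr (1 + v)"
        using c_pos[of j] by (intro mult_left_mono) auto
      also have "c j * 4 ^ j * (K * (1 + \<Phi> (m j))) = K * ((c j * (1 + \<Phi> (m j))) * 4 ^ j)"
        by (simp only: mult_ac)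
      also have "\<dots> = K * 2 ^ j"
        unfolding c_phi by (simp add: power_mult_distrib[symmetric])
      finally show ?thesis by (simp only: mult_ac)
    qed
    then have "ennreal (K * 2 ^ j) \<le> ennreal (c j * (L / 2) powr (1 + v) * 4 ^ j)"
      by (rule ennreal_leI)
    \<comment> \<open>Since \<open>y = c j / m j\<close>, the weight \<open>c j\<close> is the
      integral of the constant \<open>y\<close> over \<open>B j\<close>.\<close>
    also have "\<dots> = ennreal (y * (L / 2) powr (1 + v) * 4 ^ j) * emeasure M (B j)"
      unfolding em y_def using pos[of j] c_pos[of j] by (simp add: ennreal_mult[symmetric])
    also have "\<dots> = (\<integral>\<^sup>+x. ennreal (y * (L / 2) powr (1 + v) * 4 ^ j) * indicator (B j) x \<partial>M)"
      by (simp add: nn_integral_cmult_indicator)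
    also have "\<dots> \<le> ?I"
    proof (rule nn_integral_mono_AE, use series(1) in eventually_elim)
      fix x assume summ: "summable (\<lambda>j. g j x)"
      show "ennreal (y * (L / 2) powr (1 + v) * 4 ^ j) * indicator (B j) x
          \<le> ennreal (\<bar>f x\<bar> * ln (2 + \<bar>f x\<bar>) powr (1 + v) * extend_Psi \<Psi> \<bar>f x\<bar>)"
      proof (cases "x \<in> B j")
        case True
        \<comment> \<open>All summands are nonnegative, so the balls may overlap freely: the other
          terms only increase \<open>f\<close>.\<close>
        have "g j x \<le> f x"
          unfolding f_def using sum_le_suminf[OF summ, of "{j}"] g_nn by simp
        then have fy: "y \<le> \<bar>f x\<bar>" using True by (simp add: g_def y_def)
        have y1: "1 \<le> y" using y ge1[of j] by linarith
        have "L / 2 = ln (m j powr (-1/2))"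
          using pos[of j] by (simp add: L_def ln_powr ln_div)
        also have "\<dots> \<le> ln (2 + \<bar>f x\<bar>)"
          using y fy pos[of j] by (subst ln_le_cancel_iff) auto
        finally have "(L / 2) powr (1 + v) \<le> ln (2 + \<bar>f x\<bar>) powr (1 + v)"
          using L v by (intro powr_mono2) auto
        \<comment> \<open>Here \<open>1 \<le> m j powr (-1/2) \<le> y \<le> \<bar>f x\<bar>\<close>,
          so the extension of \<open>\<Psi>\<close> below 1 does not enter and monotonicity carries
          the bound over to \<open>\<bar>f x\<bar>\<close>.\<close>
        moreover have "4 ^ j \<le> extend_Psi \<Psi> \<bar>f x\<bar>"
          using order_trans[OF big mono_onD[OF \<open>mono_on {1..} \<Psi>\<close>]] ge1[of j] y fy y1
          by (simp add: extend_Psi_def)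
        ultimately show ?thesis
          using fy y1 True by (auto intro!: ennreal_leI mult_mono)
      qed simp
    qed
    finally show ?thesis .
  qed
  obtain R where R: "?I = ennreal R" "0 \<le> R" using finite by (cases ?I) auto
  obtain j where "R / K < 2 ^ j" using real_arch_pow[of 2 "R / K"] by auto
  then have "R < K * 2 ^ j" using K by (simp add: field_simps)
  with lower[of j] R show False by simp
qed

end
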